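(* Let $\eta>0$ and let $\mathcal{P}_0\subset\mathbb{R}^2$ be a nonempty bounded convex polytope with $b\neq0$ for all $[a,b]^T\in\mathcal{P}_0$, and assume $\mathcal{P}_0$ is strongly stabilizable, i.e. $\lambda(\mathcal{P}_0)<1$. Let $x^{RSF}_n$, $x^{WRSF}_n$, $x^{SRSF}_n$ be the state sequences generated by running the controllers $u^{RSF}$, $u^{WRSF}$, $u^{SRSF}$ (defined in the context), respectively, in closed loop with the system $x_{n+1}=ax_n+bu_n+w_n$, $[a,b]^T\in\mathcal{P}_0$, $|w_n|\le\eta$, from the same initial condition $x_0$. Assume furthermore that all three sequences obtain the same uncertainty sets $\mathcal{P}_n$. Then for all $n$ $$|x^{SRSF}_n|\le\gamma^{SRSF}_n,\qquad |x^{WRSF}_n|\le\gamma^{WRSF}_n,\qquad |x^{RSF}_n|\le\gamma^{RSF}_n,$$ where $\gamma^{SRSF}_0=\gamma^{WRSF}_0=\gamma^{RSF}_0=|x_0|$ and $$\gamma^{SRSF}_{n+1}=V_{SRSF}(\gamma^{SRSF}_n,\mathcal{P}_n),\qquad \gamma^{WRSF}_{n+1}=V_{RSF}(\gamma^{WRSF}_n,\mathcal{P}_n),\qquad \gamma^{RSF}_{n+1}=V_{RSF}(\gamma^{RSF}_n,\mathcal{P}_0).$$ Furthermore, $\gamma^{SRSF}_n\le\gamma^{WRSF}_n\le\gamma^{RSF}_n$ for all $n$.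
   Context: Notation: $a\vee b:=\max\{a,b\}$. Minima and maxima over possibly non-compact sets are read as infima/suprema in $[0,\infty]$. Stability margin and gain: for a nonempty bounded convex polytope $\mathcal{P}\subset\mathbb{R}^2$ of parameters $[a,b]^T$ with $b\ne0$ on $\mathcal{P}$, $$\lambda(\mathcal{P}):=\min_{k\in\mathbb{R}}\max_{[a,b]^T\in\mathcal{P}}|a+bk|,\qquad K(\mathcal{P}):=\operatorname{argmin}_{k}\max_{[a,b]^T\in\mathcal{P}}|a+bk|.$$ Consistent sets: $\mathcal{S}(x_{n:n+1},u_n):=\{[a,b]^T\in\mathbb{R}^2 : |x_{n+1}-ax_n-bu_n|\le\eta\}$. The uncertainty sets along a trajectory are $\mathcal{P}_{n+1}=\mathcal{P}_n\cap\mathcal{S}(x_{n:n+1},u_n)$, starting from the given $\mathcal{P}_0$. One-step reachable set: $\mathcal{R}^1_\eta(x,u,\mathcal{P}):=\{ax+bu+w : [a,b]^T\in\mathcal{P},\ |w|\le\eta\}$. Robust static state-feedback value: $$V_{RSF}(x,\mathcal{P}):=\min_{k\in\mathbb{R}}\ \max_{[a,b]^T\in\mathcal{P}}\ \max_{\|w_{0:\infty}\|_\infty\le\eta}\ \sup_{n\ge1}|x_n|,\quad x_0=x,\ x_{n+1}=(a+bk)x_n+w_n.$$ Controllers: $u^{RSF}_n=K(\mathcal{P}_0)x_n$; $$u^{WRSF}_n=\operatorname{argmin}_u\max_{x_{n+1}\in\mathcal{R}^1_\eta(x_n,u,\mathcal{P}_n)}|x_{n+1}|\vee V_{RSF}(x_{n+1},\mathcal{P}_n),$$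 given explicitly by $u^{WRSF}_n=K(\mathcal{P}_n)x_n$; $$u^{SRSF}_n=\operatorname{argmin}_u\max_{x_{n+1}\in\mathcal{R}^1_\eta(x_n,u,\mathcal{P}_n)}|x_{n+1}|\vee V_{RSF}\big(x_{n+1},\mathcal{P}_n\cap\mathcal{S}(x_{n:n+1},u)\big),$$ and $V_{SRSF}(x_n,\mathcal{P}_n)$ denotes the minimal value of this last problem. *)

theory Defs
  imports "HOL-Analysis.Analysis"
begin

text \<open>
  A parameter vector \<open>[a, b]\<^sup>T\<close> is a pair in \<^typ>\<open>real \<times> real\<close>.  All worst-case
  values live in \<^typ>\<open>ennreal\<close>, where every infimum and supremum exists.
\<close>

definition worst_gain :: "(real \<times> real) set \<Rightarrow> real \<Rightarrow> ennreal" where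
  "worst_gain P k = (SUP (a, b)\<in>P. ennreal \<bar>a + b * k\<bar>)"

definition stab_margin :: "(real \<times> real) set \<Rightarrow> ennreal" where
  "stab_margin P = (INF k. worst_gain P k)"

text \<open>The minimizer is unique for the sets considered here, see \<open>stab_gain_unique\<close> below.\<close>

definition stab_gain :: "(real \<times> real) set \<Rightarrow> real" where
  "stab_gain P = arg_min (worst_gain P) (\<lambda>_. True)"

definition consistent_set :: "real \<Rightarrow> real \<Rightarrow> real \<Rightarrow> real \<Rightarrow> (real \<times> real) set" where
  "consistent_set \<eta> x x' u = {(a, b). \<bar>x' - a * x - b * u\<bar> \<le> \<eta>}"

primrec uncertainty_set ::
  "real \<Rightarrow> (real \<times> real) set \<Rightarrow> (nat \<Rightarrow> real) \<Rightarrow> (nat \<Rightarrow> real) \<Rightarrow> nat \<Rightarrow> (real \<times> real) set" where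
  "uncertainty_set \<eta> P0 x u 0 = P0"
| "uncertainty_set \<eta> P0 x u (Suc n) =
     uncertainty_set \<eta> P0 x u n \<inter> consistent_set \<eta> (x n) (x (Suc n)) (u n)"

definition reach1 :: "real \<Rightarrow> real \<Rightarrow> real \<Rightarrow> (real \<times> real) set \<Rightarrow> real set" where
  "reach1 \<eta> x u P = {a * x + b * u + w | a b w. (a, b) \<in> P \<and> \<bar>w\<bar> \<le> \<eta>}"

primrec feedback_traj :: "real \<Rightarrow> real \<Rightarrow> real \<Rightarrow> real \<Rightarrow> (nat \<Rightarrow> real) \<Rightarrow> nat \<Rightarrow> real" where
  "feedback_traj a b k x w 0 = x"
| "feedback_traj a b k x w (Suc n) = (a + b * k) * feedback_traj a b k x w n + w n"

definition V_RSF :: "real \<Rightarrow> real \<Rightarrow> (real \<times> real) set \<Rightarrow> ennreal" where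
  "V_RSF \<eta> x P =
     (INF k. SUP (a, b)\<in>P. SUP w\<in>{w. \<forall>n. \<bar>w n\<bar> \<le> \<eta>}. SUP n\<in>{1..}.
        ennreal \<bar>feedback_traj a b k x w n\<bar>)"

definition WRSF_cost :: "real \<Rightarrow> real \<Rightarrow> (real \<times> real) set \<Rightarrow> real \<Rightarrow> ennreal" where
  "WRSF_cost \<eta> x P u = (SUP x'\<in>reach1 \<eta> x u P. max (ennreal \<bar>x'\<bar>) (V_RSF \<eta> x' P))"

definition SRSF_cost :: "real \<Rightarrow> real \<Rightarrow> (real \<times> real) set \<Rightarrow> real \<Rightarrow> ennreal" where
  "SRSF_cost \<eta> x P u =
     (SUP x'\<in>reach1 \<eta> x u P. max (ennreal \<bar>x'\<bar>) (V_RSF \<eta> x' (P \<inter> consistent_set \<eta> x x' u)))"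

definition V_SRSF :: "real \<Rightarrow> real \<Rightarrow> (real \<times> real) set \<Rightarrow> ennreal" where
  "V_SRSF \<eta> x P = (INF u. SRSF_cost \<eta> x P u)"

definition closed_loop ::
  "real \<Rightarrow> real \<Rightarrow> real \<Rightarrow> real \<Rightarrow> (nat \<Rightarrow> real) \<Rightarrow> (nat \<Rightarrow> real) \<Rightarrow> (nat \<Rightarrow> real) \<Rightarrow> bool" where
  "closed_loop \<eta> a b x0 w u x \<longleftrightarrow>
     x 0 = x0 \<and> (\<forall>n. \<bar>w n\<bar> \<le> \<eta> \<and> x (Suc n) = a * x n + b * u n + w n)"

lemma stab_gain_is_arg_min:
  assumes "(a0, b0) \<in> P" "b0 \<noteq> 0"
  shows "is_arg_min (worst_gain P) (\<lambda>_. True) (stab_gain P)"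
proof -
  have "\<exists>k. worst_gain P k \<le> stab_margin P"
  proof (cases "stab_margin P")
    case top
    then show ?thesis by simp
  next
    case (real l)
    define S where "S n = {k. \<forall>(a, b)\<in>P. \<bar>a + b * k\<bar> \<le> l + 1 / real (Suc n)}" for n
    have S_eq: "S n = (\<Inter>(a, b)\<in>P. {k. \<bar>a + b * k\<bar> \<le> l + 1 / real (Suc n)})" for n
      by (auto simp: S_def)
    have "closed (S n)" for n
      unfolding S_eq by (intro closed_INT ballI) (auto intro!: closed_Collect_le continuous_intros)
    moreover have "bounded (S n)" for n
    proof (rule boundedI)
      fix k assume "k \<in> S n"
      then have "\<bar>a0 + b0 * k\<bar> \<le> l + 1 / real (Suc n)"
        using assms by (auto simp: S_def)
      then have "\<bar>b0\<bar> * \<bar>k\<bar> \<le> l + 1 / real (Suc n) + \<bar>a0\<bar>"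
        unfolding abs_mult[symmetric] by linarith
      then show "norm k \<le> (l + 1 / real (Suc n) + \<bar>a0\<bar>) / \<bar>b0\<bar>"
        using assms(2) by (simp add: pos_le_divide_eq mult.commute)
    qed
    ultimately have "compact (S n)" for n
      by (simp add: compact_eq_bounded_closed)
    moreover have "S n \<noteq> {}" for n
    proof -
      have "stab_margin P < ennreal (l + 1 / real (Suc n))"
        using real by (simp add: ennreal_less_iff)
      then obtain k where "worst_gain P k < ennreal (l + 1 / real (Suc n))"
        unfolding stab_margin_def INF_less_iff by blast
      then have "\<forall>(a, b)\<in>P. ennreal \<bar>a + b * k\<bar> \<le> ennreal (l + 1 / real (Suc n))"
        unfolding worst_gain_def by (auto dest!: less_imp_le simp: SUP_le_iff)
      moreover have "0 \<le> l + 1 / real (Suc n)"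
        using real by simp
      ultimately have "k \<in> S n"
        unfolding S_def by (force simp del: ennreal_plus)
      then show ?thesis by blast
    qed
    moreover have "S n \<subseteq> S m" if "m \<le> n" for m n
    proof -
      have "1 / real (Suc n) \<le> 1 / real (Suc m)"
        using that by (intro divide_left_mono) auto
      then show ?thesis by (force simp: S_def)
    qed
    ultimately have "(\<Inter>(range S)) \<noteq> {}"
      by (intro compact_nest) auto
    then obtain k where k: "\<And>n. k \<in> S n" by auto
    have "\<bar>a + b * k\<bar> \<le> l" if "(a, b) \<in> P" for a b
    proof (rule field_le_epsilon)
      fix e :: real assume "e > 0"
      then obtain n where "1 / real (Suc n) < e"
        using nat_approx_posE by blast
      moreover have "\<bar>a + b * k\<bar> \<le> l + 1 / real (Suc n)"
        using k[of n] that by (auto simp: S_def)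
      ultimately show "\<bar>a + b * k\<bar> \<le> l + e" by linarith
    qed
    then have "worst_gain P k \<le> stab_margin P"
      unfolding worst_gain_def real by (auto intro!: SUP_least ennreal_leI)
    then show ?thesis ..
  qed
  then obtain k where k: "worst_gain P k \<le> stab_margin P" ..
  have "is_arg_min (worst_gain P) (\<lambda>_. True) k"
  proof -
    have "worst_gain P k \<le> worst_gain P y" for y
      using k by (rule order_trans) (auto simp: stab_margin_def intro: INF_lower)
    then show ?thesis by (simp add: is_arg_min_linorder)
  qed
  then show ?thesis
    unfolding stab_gain_def arg_min_def by (rule someI)
qed

lemma worst_gain_attained:
  assumes "compact P" "P \<noteq> {}"
  obtains a b where "(a, b) \<in> P" "worst_gain P k = ennreal \<bar>a + b * k\<bar>"
proof -
  have "continuous_on P (\<lambda>p. \<bar>fst p + snd p * k\<bar>)"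
    by (intro continuous_intros)
  from continuous_attains_sup[OF assms this] obtain p where
    p: "p \<in> P" "\<And>q. q \<in> P \<Longrightarrow> \<bar>fst q + snd q * k\<bar> \<le> \<bar>fst p + snd p * k\<bar>"
    by blast
  have "worst_gain P k = ennreal \<bar>fst p + snd p * k\<bar>"
    unfolding worst_gain_def case_prod_beta
    by (intro antisym SUP_least SUP_upper ennreal_leI p)
  then show thesis using p(1) that[of "fst p" "snd p"] by simp
qed

lemma stab_gain_unique:
  assumes "compact P" "P \<noteq> {}" and b: "\<forall>(a, b)\<in>P. b \<noteq> 0"
  shows "is_arg_min (worst_gain P) (\<lambda>_. True) k \<longleftrightarrow> k = stab_gain P"
proof
  obtain a0 b0 where ab0: "(a0, b0) \<in> P" "b0 \<noteq> 0"
    using assms by fastforce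
  show "is_arg_min (worst_gain P) (\<lambda>_. True) k" if "k = stab_gain P"
    using stab_gain_is_arg_min[OF ab0] that by simp
  show "k = stab_gain P" if "is_arg_min (worst_gain P) (\<lambda>_. True) k"
  proof (rule ccontr)
    define h where "h = stab_gain P"
    assume "k \<noteq> stab_gain P"
    then have ne: "k \<noteq> h" by (simp add: h_def)
    have min: "worst_gain P k \<le> worst_gain P y" "worst_gain P h \<le> worst_gain P y" for y
      using that stab_gain_is_arg_min[OF ab0] by (auto simp: is_arg_min_linorder h_def)
    define m where "m = (k + h) / 2"
    obtain a b' where ab: "(a, b') \<in> P" "worst_gain P m = ennreal \<bar>a + b' * m\<bar>"
      using worst_gain_attained[OF assms(1,2)] .
    have "ennreal \<bar>a + b' * k\<bar> \<le> worst_gain P k" "ennreal \<bar>a + b' * h\<bar> \<le> worst_gain P h"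
      unfolding worst_gain_def by (rule SUP_upper2[OF ab(1)]; simp)+
    with min[of m] have "ennreal \<bar>a + b' * k\<bar> \<le> ennreal \<bar>a + b' * m\<bar>"
      "ennreal \<bar>a + b' * h\<bar> \<le> ennreal \<bar>a + b' * m\<bar>"
      unfolding ab(2) by (metis order_trans)+
    then have le: "\<bar>a + b' * k\<bar> \<le> \<bar>a + b' * m\<bar>" "\<bar>a + b' * h\<bar> \<le> \<bar>a + b' * m\<bar>"
      by simp_all
    have "a + b' * m = ((a + b' * k) + (a + b' * h)) / 2"
      by (simp add: m_def field_simps)
    moreover have "p = r" if "\<bar>p\<bar> \<le> \<bar>q\<bar>" "\<bar>r\<bar> \<le> \<bar>q\<bar>" "q = (p + r) / 2" for p q r :: real
      using that by (auto simp: abs_if split: if_splits)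
    ultimately have "a + b' * k = a + b' * h" using le by blast
    with ne b ab(1) show False by auto
  qed
qed

text \<open>The value of \<^const>\<open>V_RSF\<close> is monotone in the absolute value of the initial state.\<close>

lemma V_RSF_mono:
  assumes "\<bar>x\<bar> \<le> \<bar>y\<bar>" "\<eta> \<ge> 0"
  shows "V_RSF \<eta> x P \<le> V_RSF \<eta> y P"
proof -
  have *: "\<exists>v. (\<forall>n. \<bar>v n\<bar> \<le> \<eta>) \<and>
      (\<forall>n. \<bar>feedback_traj a b k x w n\<bar> \<le> \<bar>feedback_traj a b k y v n\<bar>)"
    if w: "\<forall>n. \<bar>w n\<bar> \<le> \<eta>" for a b k and w :: "nat \<Rightarrow> real"
  proof -
    define c where "c = a + b * k"
    define s where "s z = (if z < 0 then - 1 else 1 :: real)" for z :: real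
    define z where "z = rec_nat y (\<lambda>n z. c * z + s (c * z) * \<eta>)"
    define v where "v n = s (c * z n) * \<eta>" for n
    have z: "feedback_traj a b k y v n = z n" for n
      by (induction n) (simp_all add: z_def v_def c_def)
    have "\<bar>feedback_traj a b k x w n\<bar> \<le> \<bar>z n\<bar>" for n
    proof (induction n)
      case 0
      then show ?case using assms by (simp add: z_def)
    next
      case (Suc n)
      have "\<bar>feedback_traj a b k x w (Suc n)\<bar> \<le> \<bar>c\<bar> * \<bar>feedback_traj a b k x w n\<bar> + \<bar>w n\<bar>"
        by (simp add: c_def flip: abs_mult)
      also have "\<dots> \<le> \<bar>c\<bar> * \<bar>z n\<bar> + \<eta>"
        using Suc w by (intro add_mono mult_left_mono) auto
      also have "\<dots> = \<bar>c * z n + s (c * z n) * \<eta>\<bar>"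
        using assms(2) by (auto simp: s_def simp flip: abs_mult)
      also have "\<dots> = \<bar>z (Suc n)\<bar>" by (simp add: z_def)
      finally show ?case .
    qed
    moreover have "\<bar>v n\<bar> \<le> \<eta>" for n
      using assms(2) by (simp add: v_def s_def)
    ultimately show ?thesis using z by (intro exI[of _ v]) auto
  qed
  have "(SUP w\<in>{w. \<forall>n. \<bar>w n\<bar> \<le> \<eta>}. SUP n\<in>{1..}. ennreal \<bar>feedback_traj a b k x w n\<bar>)
      \<le> (SUP w\<in>{w. \<forall>n. \<bar>w n\<bar> \<le> \<eta>}. SUP n\<in>{1..}. ennreal \<bar>feedback_traj a b k y w n\<bar>)" for a b k
  proof (rule SUP_mono)
    fix w :: "nat \<Rightarrow> real" assume "w \<in> {w. \<forall>n. \<bar>w n\<bar> \<le> \<eta>}"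
    with * obtain v :: "nat \<Rightarrow> real" where v: "\<forall>n. \<bar>v n\<bar> \<le> \<eta>"
      "\<forall>n. \<bar>feedback_traj a b k x w n\<bar> \<le> \<bar>feedback_traj a b k y v n\<bar>"
      by blast
    show "\<exists>v\<in>{w. \<forall>n. \<bar>w n\<bar> \<le> \<eta>}. (SUP n\<in>{1..}. ennreal \<bar>feedback_traj a b k x w n\<bar>)
        \<le> (SUP n\<in>{1..}. ennreal \<bar>feedback_traj a b k y v n\<bar>)"
      using v by (intro bexI[of _ v] SUP_mono) (auto intro!: ennreal_leI)
  qed
  then show ?thesis
    unfolding V_RSF_def case_prod_beta
    by - (rule INF_superset_mono[OF order_refl], rule SUP_subset_mono[OF order_refl], blast)
qed

text \<open>
  The explicit input \<open>stab_gain P * x\<close> minimizes \<^const>\<open>WRSF_cost\<close>.  It need not be the only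
  minimizer: near \<open>x = 0\<close> the cost is constant in a neighbourhood of \<open>u = 0\<close>.
\<close>

lemma stab_gain_minimizes_WRSF_cost:
  assumes "compact P" "P \<noteq> {}" and b: "\<forall>(a, b)\<in>P. b \<noteq> 0" and \<eta>: "\<eta> \<ge> 0"
  shows "is_arg_min (WRSF_cost \<eta> x P) (\<lambda>_. True) (stab_gain P * x)"
proof -
  define k where "k = stab_gain P"
  have min: "worst_gain P k \<le> worst_gain P y" for y
    using stab_gain_unique[OF assms(1-3), of k] by (auto simp: is_arg_min_linorder k_def)
  have "WRSF_cost \<eta> x P (k * x) \<le> WRSF_cost \<eta> x P u" for u
  proof -
    obtain a0 b0 where ab0: "(a0, b0) \<in> P"
      "\<And>a b. (a, b) \<in> P \<Longrightarrow> \<bar>a + b * k\<bar> * \<bar>x\<bar> \<le> \<bar>a0 * x + b0 * u\<bar>"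
    proof (cases "x = 0")
      case True
      then show ?thesis using \<open>P \<noteq> {}\<close> that by fastforce
    next
      case False
      obtain a0 b0 where ab0: "(a0, b0) \<in> P"
        "worst_gain P (u / x) = ennreal \<bar>a0 + b0 * (u / x)\<bar>"
        using worst_gain_attained[OF assms(1,2)] .
      have "\<bar>a + b * k\<bar> * \<bar>x\<bar> \<le> \<bar>a0 * x + b0 * u\<bar>" if "(a, b) \<in> P" for a b
      proof -
        have "ennreal \<bar>a + b * k\<bar> \<le> worst_gain P k"
          unfolding worst_gain_def by (rule SUP_upper2[OF that]) simp
        then have "\<bar>a + b * k\<bar> \<le> \<bar>a0 + b0 * (u / x)\<bar>"
          using min[of "u / x"] ab0(2) by (metis abs_ge_zero ennreal_le_iff order_trans)
        then have "\<bar>a + b * k\<bar> * \<bar>x\<bar> \<le> \<bar>a0 + b0 * (u / x)\<bar> * \<bar>x\<bar>"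
          by (intro mult_right_mono) auto
        also have "\<dots> = \<bar>a0 * x + b0 * u\<bar>"
          using False by (simp add: algebra_simps flip: abs_mult)
        finally show ?thesis .
      qed
      with ab0(1) show ?thesis by (rule that)
    qed
    define w0 where "w0 = (if a0 * x + b0 * u < 0 then - \<eta> else \<eta>)"
    define y where "y = a0 * x + b0 * u + w0"
    have y: "y \<in> reach1 \<eta> x u P"
      unfolding reach1_def y_def
      using ab0(1) \<eta> by (intro CollectI exI[of _ a0] exI[of _ b0] exI[of _ w0]) (auto simp: w0_def)
    show ?thesis
      unfolding WRSF_cost_def
    proof (rule SUP_mono)
      fix x' assume "x' \<in> reach1 \<eta> x (k * x) P"
      then obtain a b w where x': "x' = a * x + b * (k * x) + w" "(a, b) \<in> P" "\<bar>w\<bar> \<le> \<eta>"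
        by (auto simp: reach1_def)
      have "x' = (a + b * k) * x + w" by (simp add: x' algebra_simps)
      then have "\<bar>x'\<bar> \<le> \<bar>a + b * k\<bar> * \<bar>x\<bar> + \<eta>"
        using x'(3) abs_triangle_ineq[of "(a + b * k) * x" w] by (simp add: abs_mult)
      also have "\<dots> \<le> \<bar>a0 * x + b0 * u\<bar> + \<eta>"
        using ab0(2) x'(2) by simp
      also have "\<dots> = \<bar>y\<bar>" using \<eta> by (auto simp: y_def w0_def)
      finally have "\<bar>x'\<bar> \<le> \<bar>y\<bar>" .
      then show "\<exists>y\<in>reach1 \<eta> x u P. max (ennreal \<bar>x'\<bar>) (V_RSF \<eta> x' P)
          \<le> max (ennreal \<bar>y\<bar>) (V_RSF \<eta> y P)"
        using y V_RSF_mono[OF _ \<eta>] by (intro bexI[of _ y] max.mono ennreal_leI) auto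
    qed
  qed
  then show ?thesis by (simp add: is_arg_min_linorder k_def)
qed

end

theory Submission
  imports Defs
begin

text \<open>
  Write \<open>l\<close> for the stability margin of \<open>P\<close>.  A static gain with contraction factor \<open>c < 1\<close>
  has the worst-case trajectory \<open>|x| \<mapsto> c |x| + \<eta>\<close>, which moves monotonically towards the
  fixed point \<open>\<eta> / (1 - c)\<close>, so only its first value and its limit matter:
  \<open>V_RSF \<eta> x P = max (l |x| + \<eta>) (\<eta> / (1 - l))\<close> (lemma \<open>V_RSF_eq\<close>).  This formula is
  monotone in \<open>|x|\<close> and in \<open>P\<close>, and one step of the gain \<open>stab_gain P\<close> does not leave the
  sublevel set it describes (\<open>WRSF_cost_stab_gain_le\<close>).  That settles the bounds for the
  robust and the weakly robust controller and the comparison of all three bounds.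

  The strongly robust controller is subtler, because \<open>V_SRSF\<close> is \<^emph>\<open>not\<close> monotone in
  \<open>|x|\<close>: a small state excites the system little, so little is learnt, and the remaining
  uncertainty may cost more than a larger state would.  Hence \<open>|xS n| \<le> \<gamma>S n\<close> cannot simply be
  pushed through \<open>V_SRSF\<close>.  What saves the argument is that from the first step on
  \<open>\<gamma>S n\<close> is at least the steady-state level \<open>\<eta> / (1 - l n)\<close>, where \<open>l n\<close> is the margin of \<open>P n\<close>.
  Above this level the next state can be as large as \<open>V_RSF\<close> whatever is learnt, so
  \<open>V_SRSF\<close> and \<open>V_RSF\<close> agree there (\<open>V_SRSF_eq_V_RSF\<close>), and \<open>V_RSF\<close> dominates \<open>V_SRSF\<close> at
  every smaller state.  The level is reached at the first step because \<open>\<gamma>S 1\<close> is the optimal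
  cost at the actual initial state, which accounts for the uncertainty set \<open>P 1\<close> that is
  actually observed; it is kept afterwards because the map \<open>z \<mapsto> l z + \<eta>\<close> does not fall below its
  fixed point from above, and because the levels decrease with the sets.
\<close>

section \<open>The closed form of the robust static feedback value\<close>

lemma worst_gain_mono: "P \<subseteq> Q \<Longrightarrow> worst_gain P k \<le> worst_gain Q k"
  unfolding worst_gain_def by (rule SUP_subset_mono) auto

lemma stab_margin_mono: "P \<subseteq> Q \<Longrightarrow> stab_margin P \<le> stab_margin Q"
  unfolding stab_margin_def by (intro INF_mono) (auto intro: worst_gain_mono)

lemma V_RSF_mono_set: "P \<subseteq> Q \<Longrightarrow> V_RSF \<eta> x P \<le> V_RSF \<eta> x Q"
  unfolding V_RSF_def by (intro INF_superset_mono SUP_subset_mono) auto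

text \<open>
  A disturbance that always pushes away from the origin attains the triangle inequality at
  all times simultaneously.
\<close>

lemma worst_disturbance:
  assumes "\<eta> \<ge> 0"
  obtains w :: "nat \<Rightarrow> real" where "\<And>n. \<bar>w n\<bar> \<le> \<eta>"
    "\<And>n. \<bar>feedback_traj a b k x w (Suc n)\<bar> = \<bar>a + b * k\<bar> * \<bar>feedback_traj a b k x w n\<bar> + \<eta>"
proof -
  define c where "c = a + b * k"
  define s where "s z = (if z < 0 then - 1 else 1 :: real)" for z :: real
  define z where "z = rec_nat x (\<lambda>n z. c * z + s (c * z) * \<eta>)"
  define w where "w n = s (c * z n) * \<eta>" for n
  have z: "feedback_traj a b k x w n = z n" for n
    by (induction n) (simp_all add: z_def w_def c_def)
  show thesis
  proof (rule that)
    show "\<bar>w n\<bar> \<le> \<eta>" for n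
      using assms by (simp add: w_def s_def)
    have "\<bar>c * y + s (c * y) * \<eta>\<bar> = \<bar>c\<bar> * \<bar>y\<bar> + \<eta>" for y
      using assms by (auto simp: s_def simp flip: abs_mult)
    moreover have "z (Suc n) = c * z n + s (c * z n) * \<eta>" for n
      by (simp add: z_def)
    ultimately show "\<bar>feedback_traj a b k x w (Suc n)\<bar>
        = \<bar>a + b * k\<bar> * \<bar>feedback_traj a b k x w n\<bar> + \<eta>" for n
      unfolding z by (simp add: c_def)
  qed
qed

lemma reach1_outward:
  assumes "(a, b) \<in> P" "\<eta> \<ge> 0"
  obtains x' where "x' \<in> reach1 \<eta> x u P" "\<bar>x'\<bar> = \<bar>a * x + b * u\<bar> + \<eta>"
proof -
  define w where "w = (if a * x + b * u < 0 then - \<eta> else \<eta>)"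
  show thesis
  proof (rule that)
    show "a * x + b * u + w \<in> reach1 \<eta> x u P"
      unfolding reach1_def using assms
      by (intro CollectI exI[of _ a] exI[of _ b] exI[of _ w]) (auto simp: w_def)
    show "\<bar>a * x + b * u + w\<bar> = \<bar>a * x + b * u\<bar> + \<eta>"
      using assms by (auto simp: w_def)
  qed
qed

locale strongly_stabilizable =
  fixes P :: "(real \<times> real) set"
  assumes compact: "compact P" and nonempty: "P \<noteq> {}"
    and controllable: "\<forall>(a, b)\<in>P. b \<noteq> 0"
    and margin_less_1: "stab_margin P < 1"
begin

definition margin :: real where
  "margin = enn2real (stab_margin P)"

lemma stab_margin_eq: "stab_margin P = ennreal margin"
  using margin_less_1 unfolding margin_def
  by (metis ennreal_enn2real_if ennreal_one_less_top less_imp_neq order_less_trans)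

lemma margin_nonneg: "0 \<le> margin"
  by (simp add: margin_def)

lemma margin_less: "margin < 1"
  using margin_less_1 unfolding stab_margin_eq
  by (metis ennreal_1 ennreal_less_iff margin_nonneg)

lemma stab_gain_le_margin:
  assumes "(a, b) \<in> P"
  shows "\<bar>a + b * stab_gain P\<bar> \<le> margin"
proof -
  have "ennreal \<bar>a + b * stab_gain P\<bar> \<le> worst_gain P (stab_gain P)"
    unfolding worst_gain_def by (rule SUP_upper2[OF assms]) simp
  also have "\<dots> \<le> stab_margin P"
    using stab_gain_unique[OF compact nonempty controllable, of "stab_gain P"]
    by (auto simp: stab_margin_def is_arg_min_linorder intro: INF_greatest)
  finally show ?thesis by (simp add: stab_margin_eq margin_nonneg)
qed

lemma margin_le_some_gain:
  obtains a b where "(a, b) \<in> P" "margin \<le> \<bar>a + b * k\<bar>"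
proof -
  obtain a b where ab: "(a, b) \<in> P" "worst_gain P k = ennreal \<bar>a + b * k\<bar>"
    using worst_gain_attained[OF compact nonempty] .
  have "stab_margin P \<le> worst_gain P k"
    by (simp add: stab_margin_def INF_lower)
  then show thesis
    using that ab by (simp add: stab_margin_eq)
qed

text \<open>
  The affine contraction \<open>z \<mapsto> l z + \<eta>\<close> maps the half-line above its fixed point \<open>\<eta> / (1 - l)\<close>
  downwards and into itself.  The first part keeps worst-case trajectories below the closed
  form, the second makes the first step dominate the limit for large states.
\<close>

lemma margin_step_le:
  assumes "\<eta> / (1 - margin) \<le> M"
  shows "margin * M + \<eta> \<le> M"
  using assms margin_less by (simp add: divide_simps algebra_simps)

lemma margin_step_ge:
  assumes "\<eta> / (1 - margin) \<le> M"
  shows "\<eta> / (1 - margin) \<le> margin * M + \<eta>"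
proof -
  have "\<eta> / (1 - margin) = margin * (\<eta> / (1 - margin)) + \<eta>"
    using margin_less by (simp add: field_simps)
  also have "\<dots> \<le> margin * M + \<eta>"
    using assms margin_nonneg by (intro add_right_mono mult_left_mono)
  finally show ?thesis .
qed

text \<open>
  For the lower bound, the most expanding parameter of a given gain is combined with the
  outward disturbance: its trajectory dominates \<open>z \<mapsto> l z + \<eta>\<close>, which converges to
  \<open>\<eta> / (1 - l)\<close>.
\<close>

lemma V_RSF_eq:
  assumes \<eta>: "\<eta> \<ge> 0"
  shows "V_RSF \<eta> x P = ennreal (max (margin * \<bar>x\<bar> + \<eta>) (\<eta> / (1 - margin)))"
proof (rule antisym)
  define M where "M = max (margin * \<bar>x\<bar> + \<eta>) (\<eta> / (1 - margin))"
  have step: "margin * M + \<eta> \<le> M"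
    by (rule margin_step_le) (simp add: M_def)
  have "\<bar>feedback_traj a b (stab_gain P) x w (Suc n)\<bar> \<le> M"
    if ab: "(a, b) \<in> P" and w: "\<forall>n. \<bar>w n\<bar> \<le> \<eta>" for a b w n
  proof -
    let ?z = "feedback_traj a b (stab_gain P) x w"
    have step_z: "\<bar>?z (Suc n)\<bar> \<le> margin * \<bar>?z n\<bar> + \<eta>" for n
    proof -
      have "\<bar>?z (Suc n)\<bar> \<le> \<bar>a + b * stab_gain P\<bar> * \<bar>?z n\<bar> + \<bar>w n\<bar>"
        by (simp flip: abs_mult)
      also have "\<dots> \<le> margin * \<bar>?z n\<bar> + \<eta>"
        using stab_gain_le_margin[OF ab] w by (intro add_mono mult_right_mono) auto
      finally show ?thesis .
    qed
    show ?thesis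
    proof (induction n)
      case 0
      show ?case using step_z[of 0] by (simp add: M_def)
    next
      case (Suc n)
      have "\<bar>?z (Suc (Suc n))\<bar> \<le> margin * M + \<eta>"
        using Suc.IH margin_nonneg
        by (intro order_trans[OF step_z[of "Suc n"]] add_right_mono mult_left_mono)
      then show ?case using step by simp
    qed
  qed
  then have "(SUP (a, b)\<in>P. SUP w\<in>{w. \<forall>n. \<bar>w n\<bar> \<le> \<eta>}. SUP n\<in>{1..}.
      ennreal \<bar>feedback_traj a b (stab_gain P) x w n\<bar>) \<le> ennreal M"
    by (auto intro!: SUP_least ennreal_leI simp: Suc_le_eq gr0_conv_Suc)
  then show "V_RSF \<eta> x P \<le> ennreal M"
    unfolding V_RSF_def by (rule INF_lower2[OF UNIV_I])
next
  show "ennreal (max (margin * \<bar>x\<bar> + \<eta>) (\<eta> / (1 - margin))) \<le> V_RSF \<eta> x P"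
    unfolding V_RSF_def
  proof (rule INF_greatest)
    fix k
    obtain a b where ab: "(a, b) \<in> P" "margin \<le> \<bar>a + b * k\<bar>"
      using margin_le_some_gain .
    obtain w where w: "\<And>n. \<bar>w n\<bar> \<le> \<eta>"
      and traj: "\<And>n. \<bar>feedback_traj a b k x w (Suc n)\<bar>
          = \<bar>a + b * k\<bar> * \<bar>feedback_traj a b k x w n\<bar> + \<eta>"
      using worst_disturbance[OF \<eta>, of a b k x] by metis
    define V where "V = (SUP (a, b)\<in>P. SUP w\<in>{w. \<forall>n. \<bar>w n\<bar> \<le> \<eta>}. SUP n\<in>{1..}.
        ennreal \<bar>feedback_traj a b k x w n\<bar>)"
    let ?z = "feedback_traj a b k x w"
    have V: "ennreal \<bar>?z (Suc n)\<bar> \<le> V" for n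
      unfolding V_def by (rule SUP_upper2[OF ab(1)]) (auto simp del: feedback_traj.simps intro!: SUP_upper2[of w] SUP_upper w)
    have step_z: "margin * \<bar>?z n\<bar> + \<eta> \<le> \<bar>?z (Suc n)\<bar>" for n
      unfolding traj using ab(2) by (intro add_right_mono mult_right_mono) auto
    have first: "ennreal (margin * \<bar>x\<bar> + \<eta>) \<le> V"
      using V[of 0] step_z[of 0] by (auto intro: order_trans[OF ennreal_leI])
    have lower: "(1 - margin ^ n) * (\<eta> / (1 - margin)) \<le> \<bar>?z n\<bar>" for n
    proof (induction n)
      case (Suc n)
      have "(1 - margin ^ Suc n) * (\<eta> / (1 - margin))
          = margin * ((1 - margin ^ n) * (\<eta> / (1 - margin))) + \<eta>"
        using margin_less by (simp add: field_simps)
      also have "\<dots> \<le> margin * \<bar>?z n\<bar> + \<eta>"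
        using Suc margin_nonneg by (intro add_right_mono mult_left_mono)
      finally show ?case using step_z[of n] by simp
    qed simp
    have "(\<lambda>n. (1 - margin ^ Suc n) * (\<eta> / (1 - margin))) \<longlonglongrightarrow> (1 - 0) * (\<eta> / (1 - margin))"
      using margin_nonneg margin_less
      by (intro tendsto_intros LIMSEQ_Suc LIMSEQ_power_zero) auto
    then have "(\<lambda>n. ennreal ((1 - margin ^ Suc n) * (\<eta> / (1 - margin))))
        \<longlonglongrightarrow> ennreal (\<eta> / (1 - margin))"
      by (intro tendsto_ennrealI) simp
    then have "ennreal (\<eta> / (1 - margin)) \<le> V"
      by (rule LIMSEQ_le_const2) (use V lower in \<open>blast intro: order_trans ennreal_leI\<close>)
    with first show "ennreal (max (margin * \<bar>x\<bar> + \<eta>) (\<eta> / (1 - margin))) \<le> V"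
      by (simp add: max_def)
  qed
qed

lemma reach1_stab_gain_le:
  assumes "x' \<in> reach1 \<eta> x (stab_gain P * x) P"
  shows "\<bar>x'\<bar> \<le> margin * \<bar>x\<bar> + \<eta>"
proof -
  obtain a b w where x': "x' = a * x + b * (stab_gain P * x) + w" "(a, b) \<in> P" "\<bar>w\<bar> \<le> \<eta>"
    using assms by (auto simp: reach1_def)
  have "\<bar>(a + b * stab_gain P) * x\<bar> \<le> margin * \<bar>x\<bar>"
    unfolding abs_mult using stab_gain_le_margin[OF x'(2)] by (intro mult_right_mono) auto
  moreover have "x' = (a + b * stab_gain P) * x + w"
    by (simp add: x' algebra_simps)
  ultimately show ?thesis using x'(3) by linarith
qed

text \<open>
  Re-evaluating the value after one step of the static gain costs nothing more, since the
  value already bounds the state at all later times.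
\<close>

lemma WRSF_cost_stab_gain_le:
  assumes \<eta>: "\<eta> \<ge> 0"
  shows "WRSF_cost \<eta> x P (stab_gain P * x) \<le> V_RSF \<eta> x P"
  unfolding WRSF_cost_def
proof (rule SUP_least)
  define M where "M = max (margin * \<bar>x\<bar> + \<eta>) (\<eta> / (1 - margin))"
  fix x' assume "x' \<in> reach1 \<eta> x (stab_gain P * x) P"
  then have x': "\<bar>x'\<bar> \<le> M"
    unfolding M_def using reach1_stab_gain_le by fastforce
  have "margin * \<bar>x'\<bar> + \<eta> \<le> margin * M + \<eta>"
    using x' margin_nonneg by (intro add_right_mono mult_left_mono)
  also have "\<dots> \<le> M"
    by (rule margin_step_le) (simp add: M_def)
  finally show "max (ennreal \<bar>x'\<bar>) (V_RSF \<eta> x' P) \<le> V_RSF \<eta> x P"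
    using x' unfolding V_RSF_eq[OF \<eta>] M_def[symmetric]
    by (intro max.boundedI ennreal_leI) (auto simp: M_def)
qed

section \<open>The value with one step of learning\<close>

text \<open>Learning only shrinks the parameter set, so it never raises the value.\<close>

lemma V_SRSF_le_V_RSF:
  assumes "\<eta> \<ge> 0"
  shows "V_SRSF \<eta> x P \<le> V_RSF \<eta> x P"
proof -
  have "V_SRSF \<eta> x P \<le> SRSF_cost \<eta> x P (stab_gain P * x)"
    unfolding V_SRSF_def by (rule INF_lower) simp
  also have "\<dots> \<le> WRSF_cost \<eta> x P (stab_gain P * x)"
    unfolding SRSF_cost_def WRSF_cost_def
    by (rule SUP_subset_mono[OF order_refl], rule max.mono[OF order_refl], rule V_RSF_mono_set) simp
  also have "\<dots> \<le> V_RSF \<eta> x P"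
    by (rule WRSF_cost_stab_gain_le[OF assms])
  finally show ?thesis .
qed

text \<open>
  The next state is counted before anything has been learnt, and an input \<open>u\<close> at \<open>x \<noteq> 0\<close> is the
  static gain \<open>u / x\<close>, so no input can beat the margin.
\<close>

lemma V_SRSF_ge:
  assumes "x \<noteq> 0" and \<eta>: "\<eta> \<ge> 0"
  shows "ennreal (margin * \<bar>x\<bar> + \<eta>) \<le> V_SRSF \<eta> x P"
  unfolding V_SRSF_def
proof (rule INF_greatest)
  fix u
  obtain a b where ab: "(a, b) \<in> P" "margin \<le> \<bar>a + b * (u / x)\<bar>"
    using margin_le_some_gain .
  obtain x' where x': "x' \<in> reach1 \<eta> x u P" "\<bar>x'\<bar> = \<bar>a * x + b * u\<bar> + \<eta>"
    using reach1_outward[OF ab(1) \<eta>] .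
  have "margin * \<bar>x\<bar> \<le> \<bar>a + b * (u / x)\<bar> * \<bar>x\<bar>"
    using ab(2) by (intro mult_right_mono) auto
  also have "\<dots> = \<bar>a * x + b * u\<bar>"
    using assms(1) by (simp add: algebra_simps flip: abs_mult)
  finally have "ennreal (margin * \<bar>x\<bar> + \<eta>) \<le> ennreal \<bar>x'\<bar>"
    by (intro ennreal_leI) (simp add: x'(2))
  then show "ennreal (margin * \<bar>x\<bar> + \<eta>) \<le> SRSF_cost \<eta> x P u"
    unfolding SRSF_cost_def by (intro SUP_upper2[OF x'(1)]) (simp add: le_max_iff_disj)
qed

text \<open>
  Above the steady-state level the value is dominated by the very next state, which no
  learning can influence.
\<close>

lemma V_SRSF_eq_V_RSF:
  assumes \<eta>: "\<eta> > 0" and x: "\<eta> / (1 - margin) \<le> \<bar>x\<bar>"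
  shows "V_SRSF \<eta> x P = V_RSF \<eta> x P"
proof (rule antisym)
  show "V_SRSF \<eta> x P \<le> V_RSF \<eta> x P"
    using \<eta> by (simp add: V_SRSF_le_V_RSF)
  have "0 < \<eta> / (1 - margin)"
    using \<eta> margin_less by simp
  with x have "x \<noteq> 0" by auto
  with \<eta> show "V_RSF \<eta> x P \<le> V_SRSF \<eta> x P"
    using V_SRSF_ge[of x \<eta>] margin_step_ge[OF x] by (simp add: V_RSF_eq max_absorb1)
qed

end

lemma strongly_stabilizable_subset:
  assumes "strongly_stabilizable Q" "P \<subseteq> Q" "P \<noteq> {}" "compact P"
  shows "strongly_stabilizable P"
  using assms stab_margin_mono[OF assms(2)]
  unfolding strongly_stabilizable_def by (auto intro: le_less_trans)

text \<open>
  Reflecting state, input and next state together leaves the consistent set unchanged, so the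
  same information is learnt.
\<close>

lemma V_SRSF_minus:
  assumes "\<eta> \<ge> 0"
  shows "V_SRSF \<eta> (- x) P = V_SRSF \<eta> x P"
proof -
  have le: "V_SRSF \<eta> (- x) P \<le> V_SRSF \<eta> x P" for x
    unfolding V_SRSF_def
  proof (rule INF_mono)
    fix u
    have "SRSF_cost \<eta> (- x) P (- u) \<le> SRSF_cost \<eta> x P u"
      unfolding SRSF_cost_def
    proof (rule SUP_mono)
      fix x' assume "x' \<in> reach1 \<eta> (- x) (- u) P"
      then obtain a b w where "x' = a * (- x) + b * (- u) + w" "(a, b) \<in> P" "\<bar>w\<bar> \<le> \<eta>"
        by (auto simp: reach1_def)
      then have "- x' = a * x + b * u + - w" "(a, b) \<in> P" "\<bar>- w\<bar> \<le> \<eta>"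
        by simp_all
      then have "- x' \<in> reach1 \<eta> x u P"
        unfolding reach1_def by blast
      moreover have "consistent_set \<eta> (- x) x' (- u) = consistent_set \<eta> x (- x') u"
        by (auto simp: consistent_set_def abs_le_iff)
      ultimately show "\<exists>y\<in>reach1 \<eta> x u P.
          max (ennreal \<bar>x'\<bar>) (V_RSF \<eta> x' (P \<inter> consistent_set \<eta> (- x) x' (- u)))
          \<le> max (ennreal \<bar>y\<bar>) (V_RSF \<eta> y (P \<inter> consistent_set \<eta> x y u))"
        using assms by (intro bexI[of _ "- x'"] max.mono) (simp_all add: V_RSF_mono)
    qed
    then show "\<exists>v\<in>UNIV. SRSF_cost \<eta> (- x) P v \<le> SRSF_cost \<eta> x P u" by blast
  qed
  show ?thesis using le[of x] le[of "- x"] by simp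
qed

lemma V_SRSF_abs: "\<eta> \<ge> 0 \<Longrightarrow> V_SRSF \<eta> \<bar>x\<bar> P = V_SRSF \<eta> x P"
  by (simp add: abs_if V_SRSF_minus)

section \<open>Closed-loop trajectories\<close>

lemma closed_consistent_set: "closed (consistent_set \<eta> x x' u)"
proof -
  have "consistent_set \<eta> x x' u = {p. \<bar>x' - fst p * x - snd p * u\<bar> \<le> \<eta>}"
    by (auto simp: consistent_set_def)
  then show ?thesis by (auto intro!: closed_Collect_le continuous_intros)
qed

lemma uncertainty_set_subset: "uncertainty_set \<eta> P0 x u n \<subseteq> P0"
  by (induction n) auto

lemma compact_uncertainty_set: "compact P0 \<Longrightarrow> compact (uncertainty_set \<eta> P0 x u n)"
  by (induction n) (auto intro: compact_Int_closed closed_consistent_set)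

lemma true_parameter_in_uncertainty_set:
  assumes "closed_loop \<eta> a b x0 w u x" "(a, b) \<in> P0"
  shows "(a, b) \<in> uncertainty_set \<eta> P0 x u n"
  using assms by (induction n) (auto simp: closed_loop_def consistent_set_def)

lemma closed_loop_reach1:
  assumes "closed_loop \<eta> a b x0 w u x" "(a, b) \<in> P"
  shows "x (Suc n) \<in> reach1 \<eta> (x n) (u n) P"
  using assms unfolding closed_loop_def reach1_def by blast

theorem mainTheorem3:
  fixes \<eta> a b x0 :: real
    and P0 :: "(real \<times> real) set" and P :: "nat \<Rightarrow> (real \<times> real) set"
    and xR uR wR xW uW wW xS uS wS :: "nat \<Rightarrow> real"
    and \<gamma>R \<gamma>W \<gamma>S :: "nat \<Rightarrow> ennreal"
  assumes "\<eta> > 0"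
    and "polytope P0" "P0 \<noteq> {}" "\<forall>(a, b)\<in>P0. b \<noteq> 0"
    and "stab_margin P0 < 1"
    and "(a, b) \<in> P0"
    and "closed_loop \<eta> a b x0 wR uR xR"
    and "closed_loop \<eta> a b x0 wW uW xW"
    and "closed_loop \<eta> a b x0 wS uS xS"
    and "\<forall>n. uncertainty_set \<eta> P0 xR uR n = P n"
    and "\<forall>n. uncertainty_set \<eta> P0 xW uW n = P n"
    and "\<forall>n. uncertainty_set \<eta> P0 xS uS n = P n"
    and "\<forall>n. uR n = stab_gain P0 * xR n"
    and "\<forall>n. is_arg_min (WRSF_cost \<eta> (xW n) (P n)) (\<lambda>_. True) (uW n)"
    and "\<forall>n. is_arg_min (SRSF_cost \<eta> (xS n) (P n)) (\<lambda>_. True) (uS n)"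
    and "\<gamma>S 0 = ennreal \<bar>x0\<bar>" "\<forall>n. \<gamma>S (Suc n) = V_SRSF \<eta> (enn2real (\<gamma>S n)) (P n)"
    and "\<gamma>W 0 = ennreal \<bar>x0\<bar>" "\<forall>n. \<gamma>W (Suc n) = V_RSF \<eta> (enn2real (\<gamma>W n)) (P n)"
    and "\<gamma>R 0 = ennreal \<bar>x0\<bar>" "\<forall>n. \<gamma>R (Suc n) = V_RSF \<eta> (enn2real (\<gamma>R n)) P0"
  shows "\<forall>n. ennreal \<bar>xS n\<bar> \<le> \<gamma>S n \<and> ennreal \<bar>xW n\<bar> \<le> \<gamma>W n \<and> ennreal \<bar>xR n\<bar> \<le> \<gamma>R n
      \<and> \<gamma>S n \<le> \<gamma>W n \<and> \<gamma>W n \<le> \<gamma>R n \<and> \<gamma>R n < \<infinity>"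
proof -
  note loopR = assms(7) and loopW = assms(8) and loopS = assms(9)
  have \<eta>: "\<eta> \<ge> 0" using assms(1) by simp
  have P_0: "P 0 = P0"
    using assms(10) by (metis uncertainty_set.simps(1))
  have P_Suc: "P (Suc n) = P n \<inter> consistent_set \<eta> (xS n) (xS (Suc n)) (uS n)" for n
    using assms(12) by (metis uncertainty_set.simps(2))
  have P_sub: "P n \<subseteq> P0" for n
    using uncertainty_set_subset assms(12) by metis
  have ab: "(a, b) \<in> P n" for n
    using true_parameter_in_uncertainty_set[OF loopS assms(6)] assms(12) by metis
  have stab0: "strongly_stabilizable P0"
    using assms(2-5) by unfold_locales (auto intro: polytope_imp_compact)
  have stab: "strongly_stabilizable (P n)" for n
  proof (rule strongly_stabilizable_subset[OF stab0 P_sub])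
    show "P n \<noteq> {}" using ab by blast
    show "compact (P n)"
      using compact_uncertainty_set[OF polytope_imp_compact[OF assms(2)]] assms(12) by metis
  qed
  define level where "level n = \<eta> / (1 - strongly_stabilizable.margin (P n))" for n
  have V_RSF_finite: "V_RSF \<eta> x Q < \<infinity>" if "strongly_stabilizable Q" for x Q
    using strongly_stabilizable.V_RSF_eq[OF that \<eta>] by simp
  have V_RSF_ge_level: "ennreal (level n) \<le> V_RSF \<eta> x (P n)" for x n
    using strongly_stabilizable.V_RSF_eq[OF stab \<eta>] by (auto simp: level_def intro: ennreal_leI)
  have level_antimono: "level (Suc n) \<le> level n" for n
  proof -
    have "stab_margin (P (Suc n)) \<le> stab_margin (P n)"
      using P_Suc by (intro stab_margin_mono) auto
    then have "strongly_stabilizable.margin (P (Suc n)) \<le> strongly_stabilizable.margin (P n)"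
      using stab strongly_stabilizable.stab_margin_eq strongly_stabilizable.margin_nonneg
      by (metis ennreal_le_iff)
    then show ?thesis
      unfolding level_def using \<eta> strongly_stabilizable.margin_less[OF stab]
      by (intro divide_left_mono) auto
  qed
  have mono_enn: "V_RSF \<eta> (enn2real g) Q \<le> V_RSF \<eta> (enn2real h) Q"
    if "g \<le> h" "h < \<infinity>" for g h Q
    using that \<eta> by (intro V_RSF_mono) (auto intro: enn2real_mono)
  have mono_state: "V_RSF \<eta> x Q \<le> V_RSF \<eta> (enn2real g) Q"
    if "ennreal \<bar>x\<bar> \<le> g" "g < \<infinity>" for x g Q
    using mono_enn[OF that, of Q] V_RSF_mono[of x "\<bar>x\<bar>" \<eta> Q] \<eta> by (auto intro: order_trans)

  have \<gamma>R_finite: "\<gamma>R n < \<infinity>" for n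
    using assms(20,21) V_RSF_finite[OF stab0] by (cases n) auto
  have \<gamma>W_finite: "\<gamma>W n < \<infinity>" for n
    using assms(18,19) V_RSF_finite[OF stab] by (cases n) auto
  have \<gamma>S_finite: "\<gamma>S n < \<infinity>" for n
  proof (cases n)
    case (Suc m)
    have "\<gamma>S n \<le> V_RSF \<eta> (enn2real (\<gamma>S m)) (P m)"
      using Suc assms(17) strongly_stabilizable.V_SRSF_le_V_RSF[OF stab \<eta>] by simp
    then show ?thesis using V_RSF_finite[OF stab] by (rule le_less_trans)
  qed (use assms(16) in simp)

  have R: "ennreal \<bar>xR n\<bar> \<le> \<gamma>R n" for n
  proof (induction n)
    case 0
    then show ?case using loopR assms(20) by (simp add: closed_loop_def)
  next
    case (Suc n)
    have "xR (Suc n) \<in> reach1 \<eta> (xR n) (stab_gain P0 * xR n) P0"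
      using closed_loop_reach1[OF loopR assms(6)] assms(13) by metis
    then have "ennreal \<bar>xR (Suc n)\<bar> \<le> WRSF_cost \<eta> (xR n) P0 (stab_gain P0 * xR n)"
      unfolding WRSF_cost_def by (rule SUP_upper2) simp
    also have "\<dots> \<le> V_RSF \<eta> (xR n) P0"
      by (rule strongly_stabilizable.WRSF_cost_stab_gain_le[OF stab0 \<eta>])
    also have "\<dots> \<le> \<gamma>R (Suc n)"
      using mono_state[OF Suc \<gamma>R_finite] assms(21) by simp
    finally show ?case .
  qed

  have W: "ennreal \<bar>xW n\<bar> \<le> \<gamma>W n" for n
  proof (induction n)
    case 0
    then show ?case using loopW assms(18) by (simp add: closed_loop_def)
  next
    case (Suc n)
    have "ennreal \<bar>xW (Suc n)\<bar> \<le> WRSF_cost \<eta> (xW n) (P n) (uW n)"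
      unfolding WRSF_cost_def by (rule SUP_upper2[OF closed_loop_reach1[OF loopW ab]]) simp
    also have "\<dots> \<le> WRSF_cost \<eta> (xW n) (P n) (stab_gain (P n) * xW n)"
      using assms(14) by (simp add: is_arg_min_linorder)
    also have "\<dots> \<le> V_RSF \<eta> (xW n) (P n)"
      by (rule strongly_stabilizable.WRSF_cost_stab_gain_le[OF stab \<eta>])
    also have "\<dots> \<le> \<gamma>W (Suc n)"
      using mono_state[OF Suc \<gamma>W_finite] assms(19) by simp
    finally show ?case .
  qed

  have WR: "\<gamma>W n \<le> \<gamma>R n" for n
  proof (induction n)
    case 0
    then show ?case using assms(18,20) by simp
  next
    case (Suc n)
    have "\<gamma>W (Suc n) \<le> V_RSF \<eta> (enn2real (\<gamma>R n)) (P n)"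
      using mono_enn[OF Suc \<gamma>R_finite] assms(19) by simp
    also have "\<dots> \<le> \<gamma>R (Suc n)"
      using V_RSF_mono_set[OF P_sub] assms(21) by simp
    finally show ?case .
  qed

  have SW: "\<gamma>S n \<le> \<gamma>W n" for n
  proof (induction n)
    case 0
    then show ?case using assms(16,18) by simp
  next
    case (Suc n)
    have "\<gamma>S (Suc n) \<le> V_RSF \<eta> (enn2real (\<gamma>S n)) (P n)"
      using strongly_stabilizable.V_SRSF_le_V_RSF[OF stab \<eta>] assms(17) by simp
    also have "\<dots> \<le> \<gamma>W (Suc n)"
      using mono_enn[OF Suc \<gamma>W_finite] assms(19) by simp
    finally show ?case .
  qed

  have cost_S: "max (ennreal \<bar>xS (Suc n)\<bar>) (V_RSF \<eta> (xS (Suc n)) (P (Suc n)))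
      \<le> V_SRSF \<eta> (xS n) (P n)" for n
  proof -
    have "max (ennreal \<bar>xS (Suc n)\<bar>) (V_RSF \<eta> (xS (Suc n)) (P (Suc n)))
        \<le> SRSF_cost \<eta> (xS n) (P n) (uS n)"
      unfolding SRSF_cost_def P_Suc by (rule SUP_upper[OF closed_loop_reach1[OF loopS ab]])
    also have "\<dots> \<le> V_SRSF \<eta> (xS n) (P n)"
      unfolding V_SRSF_def using assms(15) by (auto simp: is_arg_min_linorder intro: INF_greatest)
    finally show ?thesis .
  qed
  \<comment> \<open>At the initial state no monotonicity is needed: only its sign may differ from \<open>\<gamma>S 0\<close>.\<close>
  have \<gamma>S_1: "\<gamma>S (Suc 0) = V_SRSF \<eta> (xS 0) (P 0)"
    using assms(16,17) loopS \<eta> by (simp add: closed_loop_def V_SRSF_abs)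
  have \<gamma>S_eq: "\<gamma>S (Suc n) = V_RSF \<eta> (enn2real (\<gamma>S n)) (P n)" if "ennreal (level n) \<le> \<gamma>S n" for n
  proof -
    have "level n \<le> enn2real (\<gamma>S n)"
      using that \<gamma>S_finite[of n] by (cases "\<gamma>S n") (auto simp: ennreal_le_iff)
    then show ?thesis
      using strongly_stabilizable.V_SRSF_eq_V_RSF[OF stab assms(1)] assms(17)
      by (simp add: level_def)
  qed
  have \<gamma>S_ge_level: "ennreal (level (Suc n)) \<le> \<gamma>S (Suc n)" for n
  proof (induction n)
    case 0
    show ?case
      unfolding \<gamma>S_1 using V_RSF_ge_level[of "Suc 0" "xS (Suc 0)"] cost_S[of 0]
      by (metis max.bounded_iff order_trans)
  next
    case (Suc n)
    have "ennreal (level (Suc (Suc n))) \<le> ennreal (level (Suc n))"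
      by (intro ennreal_leI level_antimono)
    also have "\<dots> \<le> \<gamma>S (Suc (Suc n))"
      unfolding \<gamma>S_eq[OF Suc] by (rule V_RSF_ge_level)
    finally show ?case .
  qed
  have S: "ennreal \<bar>xS n\<bar> \<le> \<gamma>S n" for n
  proof (induction n)
    case 0
    then show ?case using loopS assms(16) by (simp add: closed_loop_def)
  next
    case IH: (Suc n)
    have next_le: "ennreal \<bar>xS (Suc n)\<bar> \<le> V_SRSF \<eta> (xS n) (P n)"
      using cost_S[of n] by simp
    show ?case
    proof (cases n)
      case 0
      then show ?thesis using next_le \<gamma>S_1 by simp
    next
      case (Suc m)
      note next_le
      also have "V_SRSF \<eta> (xS n) (P n) \<le> V_RSF \<eta> (xS n) (P n)"
        by (rule strongly_stabilizable.V_SRSF_le_V_RSF[OF stab \<eta>])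
      also have "\<dots> \<le> V_RSF \<eta> (enn2real (\<gamma>S n)) (P n)"
        by (rule mono_state[OF IH \<gamma>S_finite])
      also have "\<dots> = \<gamma>S (Suc n)"
        using \<gamma>S_eq[of n] \<gamma>S_ge_level[of m] Suc by simp
      finally show ?thesis .
    qed
  qed
  show ?thesis using S W R SW WR \<gamma>R_finite by blast
qed

end
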